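(* Let $\omega_D,\omega_Q\in H^3(V_3,k^\times)\cong\mathsf{S}^3(x_0,x_1,x_2)/\mathbb{F}_2\langle x_i^2x_j+x_ix_j^2\mid i,j=0,1,2\rangle$ be the classes of $$\omega_D=x_0x_1x_2,\qquad\omega_Q=x_0x_1x_2+x_0x_1^2+x_0x_2^2,$$ where $V_3$ is the elementary abelian $2$-group of order $8$. Then $$\mathsf{Stab}(\omega_D)\cong S_4\qquad\text{and}\qquad\mathsf{Stab}(\omega_Q)\cong S_3 .$$
   Context: $k$ is an algebraically closed field of characteristic $0$. $V_3$ is viewed as an $\mathbb{F}_2$-vector space with coordinate functions $x_0,x_1,x_2$. The displayed isomorphism is one of $GL_3(\mathbb{F}_2)$-modules; a cubic polynomial corresponds to the image in $H^3(V_3,k^\times)$ of the class it defines in $H^3(V_3,\mathbb{F}_2)=\mathsf{S}^3(x_0,x_1,x_2)$ via $\mathbb{F}_2\cong\{\pm1\}\subset k^\times$. (The classes arise from the dihedral group $D$ and quaternion group $Q$ of order $8$.) $\mathsf{Stab}(\omega)\subset GL_3(\mathbb{F}_2)$ is the subgroup of automorphisms $a$ of $V_3$ such that $\omega\circ(a\times a\times a)$ is cohomologous to $\omega$. $S_m$ is the symmetric group of degree $m$. *)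

theory Defs
  imports
    "HOL-Analysis.Cartesian_Space"
    "HOL-Computational_Algebra.Polynomial"
    "HOL-Library.Poly_Mapping"
    "HOL-Library.Z2"
    "HOL-Algebra.Bij"
    "HOL-Algebra.Coset"
    "HOL-Algebra.Sym_Groups"
begin

section \<open>The group and its automorphisms\<close>

text \<open>
  The indices form the type \<open>3\<close>, whose elements are \<open>0\<close>, \<open>1\<close>, \<open>2\<close>;
  the coordinate function \<open>x\<^sub>i\<close> is \<open>\<lambda>v. v $ i\<close>.
\<close>

type_synonym V3 = "bit ^ 3"

definition V3_group :: "V3 monoid" where
  "V3_group = \<lparr>carrier = UNIV, mult = (+), one = 0\<rparr>"

lemma group_V3: "group V3_group"
proof (rule groupI)
  fix x assume "x \<in> carrier V3_group"
  show "\<exists>y\<in>carrier V3_group. y \<otimes>\<^bsub>V3_group\<^esub> x = \<one>\<^bsub>V3_group\<^esub>"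
    by (rule bexI[of _ "- x"]) (simp_all add: V3_group_def)
qed (simp_all add: V3_group_def add.assoc)

text \<open>\<open>AutoGroup V3_group\<close> serves as \<open>GL\<^sub>3(\<bbbF>\<^sub>2)\<close>:\<close>

lemma auto_V3_iff: "a \<in> auto V3_group \<longleftrightarrow> bij a \<and> Vector_Spaces.linear (*s) (*s) a"
proof -
  have "Vector_Spaces.linear (*s) (*s) a \<longleftrightarrow> (\<forall>x y. a (x + y) = a x + a y)"
  proof
    assume add: "\<forall>x y. a (x + y) = a x + a y"
    have "a 0 = 0"
      using add by (metis add_cancel_right_right)
    moreover have "(0::bit) *s v = 0" "(1::bit) *s v = v" for v :: V3
      by (simp_all add: vec_eq_iff)
    ultimately have "a (c *s v) = c *s a v" for c v
      by (cases c) simp_all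
    then show "Vector_Spaces.linear (*s) (*s) a"
      using add by unfold_locales (auto simp: vector_add_ldistrib vector_sadd_rdistrib)
  qed (auto simp: Vector_Spaces.linear_iff)
  then show ?thesis
    by (auto simp: auto_def V3_group_def hom_def Bij_def)
qed


section \<open>Degree-three cohomology with trivial coefficients in the multiplicative group\<close>

type_synonym ('v, 'k) cochain3 = "'v \<Rightarrow> 'v \<Rightarrow> 'v \<Rightarrow> 'k"

definition coboundary2 :: "('v::group_add \<Rightarrow> 'v \<Rightarrow> 'k::field) \<Rightarrow> ('v, 'k) cochain3" where
  "coboundary2 \<mu> = (\<lambda>x y z. \<mu> y z * inverse (\<mu> (x + y) z) * \<mu> x (y + z) * inverse (\<mu> x y))"

definition Z3 :: "('v::group_add, 'k::field) cochain3 monoid" where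
  "Z3 = \<lparr>carrier = {\<omega>. (\<forall>x y z. \<omega> x y z \<noteq> 0) \<and>
           (\<forall>w x y z. \<omega> x y z * \<omega> w (x + y) z * \<omega> w x y = \<omega> (w + x) y z * \<omega> w x (y + z))},
         mult = (\<lambda>\<omega> \<eta> x y z. \<omega> x y z * \<eta> x y z),
         one = (\<lambda>x y z. 1)\<rparr>"

definition B3 :: "('v::group_add, 'k::field) cochain3 set" where
  "B3 = {coboundary2 \<mu> | \<mu>. \<forall>x y. \<mu> x y \<noteq> 0}"

definition H3 :: "('v::group_add, 'k::field) cochain3 set monoid" where
  "H3 = Z3 Mod B3"

definition H3_class :: "('v::group_add, 'k::field) cochain3 \<Rightarrow> ('v, 'k) cochain3 set" where
  "H3_class \<omega> = B3 #>\<^bsub>Z3\<^esub> \<omega>"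

definition cohomologous :: "('v::group_add, 'k::field) cochain3 \<Rightarrow> ('v, 'k) cochain3 \<Rightarrow> bool" where
  "cohomologous \<omega> \<eta> \<longleftrightarrow> \<omega> \<in> carrier Z3 \<and> \<eta> \<in> carrier Z3 \<and> H3_class \<omega> = H3_class \<eta>"

lemma comm_group_Z3: "comm_group (Z3 :: ('v::group_add, 'k::field) cochain3 monoid)"
proof (rule comm_groupI)
  fix \<omega> :: "('v, 'k) cochain3" assume w: "\<omega> \<in> carrier Z3"
  have "(\<lambda>x y z. inverse (\<omega> x y z)) \<in> carrier Z3"
    using w by (auto simp: Z3_def simp flip: inverse_mult_distrib)
  then show "\<exists>\<eta>\<in>carrier Z3. \<eta> \<otimes>\<^bsub>Z3\<^esub> \<omega> = \<one>\<^bsub>Z3\<^esub>"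
    by (rule bexI[rotated]) (use w in \<open>simp add: Z3_def\<close>)
next
  fix \<omega> \<eta> :: "('v, 'k) cochain3" assume w: "\<omega> \<in> carrier Z3" "\<eta> \<in> carrier Z3"
  have "\<omega> x y z * \<eta> x y z * (\<omega> w (x + y) z * \<eta> w (x + y) z) * (\<omega> w x y * \<eta> w x y) =
      \<omega> (w + x) y z * \<eta> (w + x) y z * (\<omega> w x (y + z) * \<eta> w x (y + z))" (is "?l = ?r") for w x y z
  proof -
    have "?l = (\<omega> x y z * \<omega> w (x + y) z * \<omega> w x y) * (\<eta> x y z * \<eta> w (x + y) z * \<eta> w x y)"
      by (simp add: mult_ac)
    also have "\<dots> = (\<omega> (w + x) y z * \<omega> w x (y + z)) * (\<eta> (w + x) y z * \<eta> w x (y + z))"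
      using w by (simp add: Z3_def)
    finally show ?thesis
      by (simp add: mult_ac)
  qed
  then show "\<omega> \<otimes>\<^bsub>Z3\<^esub> \<eta> \<in> carrier Z3"
    using w by (simp add: Z3_def)
qed (auto simp: Z3_def mult_ac)

lemma subgroup_B3: "subgroup (B3 :: ('v::group_add, 'k::field) cochain3 set) Z3"
proof (rule group.subgroupI)
  show "group (Z3 :: ('v, 'k) cochain3 monoid)"
    using comm_group_Z3 by (rule comm_group.axioms)
  show sub: "(B3 :: ('v, 'k) cochain3 set) \<subseteq> carrier Z3"
  proof
    fix \<omega> :: "('v, 'k) cochain3" assume "\<omega> \<in> B3"
    then obtain \<mu> where "\<omega> = coboundary2 \<mu>" "\<forall>x y. \<mu> x y \<noteq> 0"
      by (auto simp: B3_def)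
    then show "\<omega> \<in> carrier Z3"
      by (simp add: Z3_def coboundary2_def add.assoc divide_simps)
  qed
  have "coboundary2 (\<lambda>_ _. 1) \<in> (B3 :: ('v, 'k) cochain3 set)"
    unfolding B3_def by (intro CollectI exI[of _ "\<lambda>_ _. 1"]) simp
  then show "(B3 :: ('v, 'k) cochain3 set) \<noteq> {}"
    by blast
  fix \<omega> :: "('v, 'k) cochain3" assume w: "\<omega> \<in> B3"
  then obtain \<mu> where m: "\<omega> = coboundary2 \<mu>" "\<forall>x y. \<mu> x y \<noteq> 0"
    by (auto simp: B3_def)
  let ?i = "coboundary2 (\<lambda>x y. inverse (\<mu> x y))"
  have i: "?i \<in> B3"
    unfolding B3_def using m(2) by (intro CollectI exI[of _ "\<lambda>x y. inverse (\<mu> x y)"]) simp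
  have "?i \<otimes>\<^bsub>Z3\<^esub> \<omega> = \<one>\<^bsub>Z3\<^esub>"
    using m by (simp add: Z3_def coboundary2_def divide_simps)
  then have "inv\<^bsub>Z3\<^esub> \<omega> = ?i"
    using \<open>group Z3\<close> sub w i by (intro group.inv_equality) auto
  with i show "inv\<^bsub>Z3\<^esub> \<omega> \<in> B3"
    by simp
  fix \<eta> :: "('v, 'k) cochain3" assume "\<eta> \<in> B3"
  then obtain \<nu> where n: "\<eta> = coboundary2 \<nu>" "\<forall>x y. \<nu> x y \<noteq> 0"
    by (auto simp: B3_def)
  have "\<omega> \<otimes>\<^bsub>Z3\<^esub> \<eta> = coboundary2 (\<lambda>x y. \<mu> x y * \<nu> x y)"
    using m n by (simp add: Z3_def coboundary2_def mult_ac)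
  then show "\<omega> \<otimes>\<^bsub>Z3\<^esub> \<eta> \<in> B3"
    unfolding B3_def using m(2) n(2) by (intro CollectI exI[of _ "\<lambda>x y. \<mu> x y * \<nu> x y"]) simp
qed

lemma comm_group_H3: "comm_group (H3 :: ('v::group_add, 'k::field) cochain3 set monoid)"
  unfolding H3_def by (intro comm_group.abelian_FactGroup comm_group_Z3 subgroup_B3)

lemma mem_H3_class_self: "\<omega> \<in> carrier Z3 \<Longrightarrow> \<omega> \<in> H3_class \<omega>"
  unfolding H3_class_def
  by (rule group.rcos_self[OF comm_group.axioms(2)[OF comm_group_Z3] _ subgroup_B3])


section \<open>Classes of cubic polynomials\<close>

type_synonym poly3 = "(3 \<Rightarrow>\<^sub>0 nat) \<Rightarrow>\<^sub>0 bit"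

definition X :: "3 \<Rightarrow> poly3" where
  "X i = Poly_Mapping.single (Poly_Mapping.single i 1) 1"

text \<open>
  In \<open>H\<^sup>3(V\<^sub>3, \<bbbF>\<^sub>2)\<close> the monomial \<open>x\<^sub>i x\<^sub>j x\<^sub>k\<close> is the cup product of the coordinate functions
  (homomorphisms \<open>V\<^sub>3 \<rightarrow> \<bbbF>\<^sub>2\<close>, that is, 1-cocycles), which is represented by the cocycle
  \<open>(a, b, c) \<mapsto> a\<^sub>i b\<^sub>j c\<^sub>k\<close>. Another order of the factors gives a cohomologous cocycle; we take
  \<open>i \<le> j \<le> k\<close>. Only the part of \<open>p\<close> that is homogeneous of degree 3 is used.
\<close>

definition cubic_cocycle :: "poly3 \<Rightarrow> (V3, bit) cochain3" where
  "cubic_cocycle p = (\<lambda>a b c. \<Sum>(i, j, k)\<in>{(i, j, k). i \<le> j \<and> j \<le> k}.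
     Poly_Mapping.lookup p
       (Poly_Mapping.single i 1 + Poly_Mapping.single j 1 + Poly_Mapping.single k 1)
     * (a $ i * b $ j * c $ k))"

definition bit_sign :: "bit \<Rightarrow> 'k::field" where
  "bit_sign b = (if b = 0 then 1 else - 1)"

definition H3_of_cubic :: "poly3 \<Rightarrow> (V3, 'k::field) cochain3 set" where
  "H3_of_cubic p = H3_class (\<lambda>a b c. bit_sign (cubic_cocycle p a b c))"

lemma bit_sign_add: "bit_sign (a + b) = bit_sign a * bit_sign b"
  by (cases a; cases b) (simp_all add: bit_sign_def)

lemma cubic_cocycle_in_Z3:
  "(\<lambda>a b c. bit_sign (cubic_cocycle p a b c)) \<in> carrier (Z3 :: (V3, 'k::field) cochain3 monoid)"
proof -
  have "cubic_cocycle p x y z + cubic_cocycle p w (x + y) z + cubic_cocycle p w x y =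
      cubic_cocycle p (w + x) y z + cubic_cocycle p w x (y + z)" for w x y z
  proof -
    have c: "f * (x $ i * y $ j * z $ k) + f * (w $ i * (x $ j + y $ j) * z $ k) + f * (w $ i * x $ j * y $ k) =
      f * ((w $ i + x $ i) * y $ j * z $ k) + f * (w $ i * x $ j * (y $ k + z $ k))" for f i j k
      by (simp only: distrib_left distrib_right mult.assoc) (simp only: ac_simps)
    show ?thesis
      unfolding cubic_cocycle_def sum.distrib[symmetric]
      by (rule sum.cong) (auto simp: c)
  qed
  then show ?thesis
    by (simp add: Z3_def flip: bit_sign_add) (simp add: bit_sign_def)
qed

lemma H3_of_cubic_in_H3: "H3_of_cubic p \<in> carrier H3"
  using cubic_cocycle_in_Z3 unfolding H3_of_cubic_def H3_class_def H3_def carrier_FactGroup by blast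

lemma cubic_cocycle_add:
  "cubic_cocycle (p + q) = (\<lambda>a b c. cubic_cocycle p a b c + cubic_cocycle q a b c)"
  by (simp only: cubic_cocycle_def lookup_add distrib_right split_def sum.distrib)

lemma cubic_cocycle_monomial:
  assumes "i \<le> j" "j \<le> k"
  shows "cubic_cocycle (X i * X j * X k) = (\<lambda>a b c. a $ i * b $ j * c $ k)"
proof -
  let ?e = "\<lambda>i j k :: 3. Poly_Mapping.single i (1::nat) + Poly_Mapping.single j 1 + Poly_Mapping.single k 1"
  have inj: "(i, j, k) = (i', j', k')" if "?e i j k = ?e i' j' k'" "i' \<le> j'" "j' \<le> k'" for i' j' k'
  proof -
    have "count (mset [p, q, r]) l = Poly_Mapping.lookup (?e p q r) l" for p q r l
      by (simp add: lookup_add lookup_single when_def)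
    then have "mset [i, j, k] = mset [i', j', k']"
      using that(1) by (metis multiset_eqI)
    then have "sort [i, j, k] = [i', j', k']"
      using that(2,3) by (intro properties_for_sort) auto
    moreover have "sort [i, j, k] = [i, j, k]"
      using assms by (intro sorted_sort_id) auto
    ultimately show ?thesis
      by simp
  qed
  have "X i * X j * X k = Poly_Mapping.single (?e i j k) 1"
    by (simp add: X_def mult_single)
  then have l: "Poly_Mapping.lookup (X i * X j * X k) (?e i' j' k') = (if (i', j', k') = (i, j, k) then 1 else 0)"
    if "i' \<le> j'" "j' \<le> k'" for i' j' k'
    using inj[of i' j' k'] that by (auto simp only: lookup_single when_def split: if_splits)
  have "cubic_cocycle (X i * X j * X k) = (\<lambda>a b c. \<Sum>t\<in>{(i, j, k). i \<le> j \<and> j \<le> k}.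
      if t = (i, j, k) then a $ i * b $ j * c $ k else 0)"
    unfolding cubic_cocycle_def
    by (intro ext sum.cong refl, clarify, subst l) auto
  then show ?thesis
    using assms by simp
qed

lemma order_3: "(0::3) \<le> 1" "(1::3) \<le> 2" "(0::3) \<le> 2"
  by (simp_all add: less_eq_bit1_def bit1.Rep_0 bit1.Rep_1 bit1.Rep_numeral)

lemma cubic_cocycle_D:
  "cubic_cocycle (X 0 * X 1 * X 2) = (\<lambda>a b c. a $ 0 * b $ 1 * c $ 2)"
  by (intro cubic_cocycle_monomial order_3)

lemma cubic_cocycle_Q:
  "cubic_cocycle (X 0 * X 1 * X 2 + X 0 * X 1 ^ 2 + X 0 * X 2 ^ 2) =
    (\<lambda>a b c. a $ 0 * b $ 1 * c $ 2 + a $ 0 * b $ 1 * c $ 1 + a $ 0 * b $ 2 * c $ 2)"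
  unfolding power2_eq_square mult.assoc[symmetric] cubic_cocycle_add
  by (simp only: cubic_cocycle_monomial order_3 order_refl)


section \<open>Stabilizers\<close>

definition Stab :: "(V3, 'k::field) cochain3 \<Rightarrow> (V3 \<Rightarrow> V3) set" where
  "Stab \<omega> = {a \<in> auto V3_group. cohomologous (\<lambda>x y z. \<omega> (a x) (a y) (a z)) \<omega>}"

definition Stab_group :: "(V3, 'k::field) cochain3 \<Rightarrow> (V3 \<Rightarrow> V3) monoid" where
  "Stab_group \<omega> = AutoGroup V3_group \<lparr>carrier := Stab \<omega>\<rparr>"

lemma cohomologous_iff:
  fixes \<omega> \<eta> :: "('v::group_add, 'k::field) cochain3"
  assumes "\<omega> \<in> carrier Z3" "\<eta> \<in> carrier Z3"
  shows "cohomologous \<omega> \<eta> \<longleftrightarrow>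
    (\<exists>\<mu>. (\<forall>x y. \<mu> x y \<noteq> 0) \<and> \<omega> = (\<lambda>x y z. coboundary2 \<mu> x y z * \<eta> x y z))"
proof -
  have g: "group (Z3 :: ('v, 'k) cochain3 monoid)"
    using comm_group_Z3 by (rule comm_group.axioms)
  have "cohomologous \<omega> \<eta> \<longleftrightarrow> \<omega> \<in> B3 #>\<^bsub>Z3\<^esub> \<eta>"
    unfolding cohomologous_def H3_class_def
    using assms group.repr_independence[OF g _ _ subgroup_B3, of \<omega> \<eta>]
      group.rcos_self[OF g _ subgroup_B3, of \<omega>] by auto
  also have "\<dots> \<longleftrightarrow> (\<exists>\<beta>\<in>B3. \<omega> = \<beta> \<otimes>\<^bsub>Z3\<^esub> \<eta>)"
    by (auto simp: r_coset_def)
  also have "\<dots> \<longleftrightarrow> (\<exists>\<mu>. (\<forall>x y. \<mu> x y \<noteq> 0) \<and> \<omega> = (\<lambda>x y z. coboundary2 \<mu> x y z * \<eta> x y z))"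
    by (auto simp: B3_def Z3_def)
  finally show ?thesis .
qed

lemma cohomologous_pullback:
  assumes "a \<in> auto V3_group" "cohomologous \<omega> \<eta>"
  shows "cohomologous (\<lambda>x y z. \<omega> (a x) (a y) (a z)) (\<lambda>x y z. \<eta> (a x) (a y) (a z))"
proof -
  have add: "a (x + y) = a x + a y" for x y
    using assms(1) by (simp add: auto_def hom_def V3_group_def)
  have Z: "(\<lambda>x y z. \<theta> (a x) (a y) (a z)) \<in> carrier Z3" if "\<theta> \<in> carrier Z3"
    for \<theta> :: "(V3, 'a) cochain3"
    using that by (simp add: Z3_def add)
  have w: "\<omega> \<in> carrier Z3" "\<eta> \<in> carrier Z3"
    using assms(2) by (simp_all add: cohomologous_def)
  then obtain \<mu> where "\<forall>x y. \<mu> x y \<noteq> 0" "\<omega> = (\<lambda>x y z. coboundary2 \<mu> x y z * \<eta> x y z)"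
    using assms(2) cohomologous_iff[OF w] by blast
  then show ?thesis
    by (subst cohomologous_iff[OF Z Z, OF w], intro exI[of _ "\<lambda>x y. \<mu> (a x) (a y)"])
      (simp add: coboundary2_def add)
qed

lemma subgroup_Stab:
  assumes "\<omega> \<in> carrier Z3"
  shows "subgroup (Stab \<omega>) (AutoGroup V3_group)"
proof (rule group.subgroupI)
  show "group (AutoGroup V3_group)"
    by (rule group.AutoGroup[OF group_V3])
  then interpret A: group "AutoGroup V3_group" .
  have carrier: "carrier (AutoGroup V3_group) = auto V3_group"
    by (simp add: AutoGroup_def)
  have one: "\<one>\<^bsub>AutoGroup V3_group\<^esub> = (\<lambda>x. x)"
    by (simp add: AutoGroup_def BijGroup_def V3_group_def fun_eq_iff)
  have mult: "f \<otimes>\<^bsub>AutoGroup V3_group\<^esub> g = (\<lambda>x. f (g x))"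
    if "f \<in> auto V3_group" "g \<in> auto V3_group" for f g
    using that by (auto simp: AutoGroup_def BijGroup_def V3_group_def auto_def compose_def fun_eq_iff)
  show "Stab \<omega> \<subseteq> carrier (AutoGroup V3_group)"
    by (auto simp: carrier Stab_def)
  have "(\<lambda>x. x) \<in> Stab \<omega>"
    using assms A.one_closed unfolding one carrier by (simp add: Stab_def cohomologous_def)
  then show "Stab \<omega> \<noteq> {}"
    by blast
  fix a assume a: "a \<in> Stab \<omega>"
  let ?i = "inv\<^bsub>AutoGroup V3_group\<^esub> a"
  have i: "?i \<in> auto V3_group"
    using a A.inv_closed by (auto simp: Stab_def carrier)
  have aa: "a \<in> auto V3_group"
    using a by (simp add: Stab_def)
  have "(\<lambda>x. a (?i x)) = (\<lambda>x. x)"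
    using A.r_inv[of a] aa mult[OF aa i] by (simp add: carrier one)
  then have "a (?i x) = x" for x
    by (rule fun_cong)
  then have "cohomologous \<omega> (\<lambda>x y z. \<omega> (?i x) (?i y) (?i z))"
    using cohomologous_pullback[OF i, of "\<lambda>x y z. \<omega> (a x) (a y) (a z)" \<omega>] a by (simp add: Stab_def)
  then show "?i \<in> Stab \<omega>"
    using i by (simp add: Stab_def cohomologous_def)
  fix b assume b: "b \<in> Stab \<omega>"
  have "cohomologous (\<lambda>x y z. \<omega> (a (b x)) (a (b y)) (a (b z))) (\<lambda>x y z. \<omega> (b x) (b y) (b z))"
    using cohomologous_pullback[of b "\<lambda>x y z. \<omega> (a x) (a y) (a z)" \<omega>] a b by (simp add: Stab_def)
  moreover have "(\<lambda>x. a (b x)) \<in> auto V3_group"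
    using A.m_closed[of a b] a b by (simp add: carrier mult Stab_def)
  ultimately show "a \<otimes>\<^bsub>AutoGroup V3_group\<^esub> b \<in> Stab \<omega>"
    using a b by (simp add: mult Stab_def cohomologous_def)
qed

end

theory Submission
  imports Defs
begin

text \<open>
  A trilinear form \<open>t\<close> over \<open>\<bbbF>\<^sub>2\<close> gives the cocycle \<open>(-1)\<^sup>t\<close>. Its class restricted to the subgroup
  generated by \<open>x\<close> is \<open>t x x x\<close>, and conversely a form with vanishing diagonal gives a coboundary:
  such forms are spanned by those of type \<open>fgh + gfh\<close> and \<open>fgh + fhg\<close>, which are coboundaries already
  over \<open>\<bbbF>\<^sub>2\<close>, and \<open>ffg + fgg\<close>, which becomes one thanks to a square root of \<open>- 1\<close>. Hence the
  stabilizer of a class is the stabilizer of the function \<open>F x = t x x x\<close>. For \<open>\<omega>\<^sub>D\<close>, \<open>F\<close> is the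
  indicator of \<open>(1, 1, 1)\<close>, and its stabilizer permutes the four functionals with value \<open>1\<close> at this
  vector; for \<open>\<omega>\<^sub>Q\<close>, \<open>F\<close> is the indicator of a basis. In both cases every permutation occurs.
\<close>

section \<open>Arithmetic in characteristic two and linear functionals\<close>

lemma bit_add_self: "(a::bit) + a = 0" "a + (a + b) = (b::bit)"
  by (cases a; cases b; simp)+

lemma V3_add_self: "(v::V3) + v = 0"
  by (simp only: vec_eq_iff vector_add_component bit_add_self zero_index simp_thms)

lemma UNIV_type_3: "(UNIV :: 3 set) = {0, 1, 2}"
  using UNIV_3 by auto

lemma sum_type_3: "sum f (UNIV :: 3 set) = f 0 + f 1 + f 2"
  unfolding UNIV_type_3 by (simp add: add.assoc)

lemma V3_eq_iff: "(x::V3) = y \<longleftrightarrow> x $ 0 = y $ 0 \<and> x $ 1 = y $ 1 \<and> x $ 2 = y $ 2"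
proof -
  have "(\<forall>i::3. P i) \<longleftrightarrow> P 0 \<and> P 1 \<and> P 2" for P
    using UNIV_type_3 by (metis UNIV_I insertE singletonD)
  then show ?thesis
    by (simp add: vec_eq_iff)
qed

lemma additive_bit_expansion:
  fixes f :: "bit ^ 'n \<Rightarrow> bit"
  assumes "additive f"
  shows "f x = (\<Sum>i\<in>UNIV. x $ i * f (axis i 1))"
proof -
  interpret additive f by fact
  have "f (c *s v) = c * f v" for c v
    by (cases c) (simp_all add: zero)
  moreover have "f x = f (\<Sum>i\<in>UNIV. x $ i *s axis i 1)"
    by (simp only: basis_expansion)
  ultimately show ?thesis
    by (simp only: sum)
qed

section \<open>Elementary coboundaries among sign cochains\<close>

definition sign_cochain :: "('v, bit) cochain3 \<Rightarrow> ('v, 'k::field) cochain3" where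
  "sign_cochain t = (\<lambda>x y z. bit_sign (t x y z))"

lemma sign_cochain_B3I:
  fixes \<mu> :: "'v::group_add \<Rightarrow> 'v \<Rightarrow> 'k::field"
  assumes "\<And>x y. \<mu> x y \<noteq> 0" "\<And>x y z. coboundary2 \<mu> x y z = bit_sign (t x y z)"
  shows "sign_cochain t \<in> (B3 :: ('v, 'k) cochain3 set)"
proof -
  have "sign_cochain t = coboundary2 \<mu>"
    by (simp add: sign_cochain_def assms(2) fun_eq_iff)
  then show ?thesis
    using assms(1) by (auto simp: B3_def)
qed

lemma sign_cochain_add_B3:
  assumes "sign_cochain s \<in> (B3 :: ('v::group_add, 'k::field) cochain3 set)"
    and "sign_cochain t \<in> (B3 :: ('v, 'k) cochain3 set)"
  shows "sign_cochain (\<lambda>x y z. s x y z + t x y z) \<in> (B3 :: ('v, 'k) cochain3 set)"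
  using subgroup.m_closed[OF subgroup_B3 assms]
  by (simp only: sign_cochain_def bit_sign_add Z3_def monoid.simps)

text \<open>The scalar is 0 or 1. With closure under sums, the cochains whose signs are coboundaries
  form an F_2-vector space, so it suffices to treat spanning elements.\<close>

lemma sign_cochain_scale_B3:
  assumes "sign_cochain t \<in> (B3 :: ('v::group_add, 'k::field) cochain3 set)"
  shows "sign_cochain (\<lambda>x y z. c * t x y z) \<in> (B3 :: ('v, 'k) cochain3 set)"
proof (cases "c = 0")
  case True
  moreover have "\<one>\<^bsub>Z3\<^esub> \<in> (B3 :: ('v, 'k) cochain3 set)"
    by (rule subgroup.one_closed[OF subgroup_B3])
  ultimately show ?thesis
    by (simp add: sign_cochain_def Z3_def bit_sign_def)
qed (use assms in \<open>simp del: mult_bit_eq_and\<close>)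

text \<open>The cup product commutes in its first two factors: over F_2 the function
  \<open>f x * g x\<close> has coboundary \<open>f x * g y + g x * f y\<close>.\<close>

lemma swap_left_B3:
  fixes f g h :: "'v::ab_group_add \<Rightarrow> bit"
  assumes "additive f" "additive g" "additive h"
  shows "sign_cochain (\<lambda>x y z. f x * g y * h z + g x * f y * h z)
    \<in> (B3 :: ('v, 'k::field) cochain3 set)"
proof (rule sign_cochain_B3I[where \<mu> = "\<lambda>x y. bit_sign (f x * g x * h y)"])
  fix x y z
  show "coboundary2 (\<lambda>x y. bit_sign (f x * g x * h y)) x y z =
      (bit_sign (f x * g y * h z + g x * f y * h z) :: 'k)"
    unfolding coboundary2_def assms[THEN additive.add]
    by (cases "f x"; cases "f y"; cases "g x"; cases "g y"; cases "h y"; cases "h z")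
      (simp_all add: bit_sign_def)
qed (simp add: bit_sign_def)

lemma swap_right_B3:
  fixes f g h :: "'v::ab_group_add \<Rightarrow> bit"
  assumes "additive f" "additive g" "additive h"
  shows "sign_cochain (\<lambda>x y z. f x * g y * h z + f x * h y * g z)
    \<in> (B3 :: ('v, 'k::field) cochain3 set)"
proof (rule sign_cochain_B3I[where \<mu> = "\<lambda>x y. bit_sign (f x * g y * h y)"])
  fix x y z
  show "coboundary2 (\<lambda>x y. bit_sign (f x * g y * h y)) x y z =
      (bit_sign (f x * g y * h z + f x * h y * g z) :: 'k)"
    unfolding coboundary2_def assms[THEN additive.add]
    by (cases "f x"; cases "f y"; cases "g z"; cases "g y"; cases "h y"; cases "h z")
      (simp_all add: bit_sign_def)
qed (simp add: bit_sign_def)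

text \<open>The bounding cochain is \<open>\<iota>\<close> to the power \<open>f x * g y\<close>,
  bits being read as integers. As an integer, \<open>f (x + y)\<close> is
  \<open>f x + f y - 2 * f x * f y\<close>; the correction becomes a sign because
  \<open>\<iota> ^ 2 = - 1\<close>.\<close>

lemma bockstein_B3:
  fixes f g :: "'v::ab_group_add \<Rightarrow> bit"
  assumes "additive f" "additive g"
  shows "sign_cochain (\<lambda>x y z. f x * f y * g z + f x * g y * g z)
    \<in> (B3 :: ('v, 'k::alg_closed_field) cochain3 set)"
proof -
  obtain \<iota> :: 'k where i: "\<iota> ^ 2 = - 1"
    using nth_root_exists[of 2 "- 1 :: 'k"] by auto
  then have i0: "\<iota> \<noteq> 0" and i1: "inverse \<iota> = - \<iota>"
    by (auto intro!: inverse_unique simp: power2_eq_square)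
  let ?\<mu> = "\<lambda>x y. if f x = 1 \<and> g y = 1 then \<iota> else 1"
  show ?thesis
  proof (rule sign_cochain_B3I[where \<mu> = ?\<mu>])
    fix x y z
    show "coboundary2 ?\<mu> x y z = (bit_sign (f x * f y * g z + f x * g y * g z) :: 'k)"
      unfolding coboundary2_def assms[THEN additive.add]
      using i i0 i1 by (cases "f x"; cases "f y"; cases "g y"; cases "g z")
        (simp_all add: bit_sign_def power2_eq_square)
  qed (use i0 in simp)
qed


section \<open>Trilinear forms with vanishing diagonal\<close>

definition trilinear :: "('v::ab_group_add, bit) cochain3 \<Rightarrow> bool" where
  "trilinear t \<longleftrightarrow> (\<forall>y z. additive (\<lambda>x. t x y z)) \<and> (\<forall>x z. additive (\<lambda>y. t x y z)) \<and>
     (\<forall>x y. additive (t x y))"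

lemma trilinear_add:
  assumes "trilinear t"
  shows "t (x + x') y z = t x y z + t x' y z" "t x (y + y') z = t x y z + t x y' z"
    "t x y (z + z') = t x y z + t x y z'"
  using assms unfolding trilinear_def by (meson additive.add)+

lemma trilinearI:
  assumes "\<And>x x' y z. t (x + x') y z = t x y z + t x' y z"
    "\<And>x y y' z. t x (y + y') z = t x y z + t x y' z"
    "\<And>x y z z'. t x y (z + z') = t x y z + t x y z'"
  shows "trilinear t"
  using assms by (simp only: trilinear_def additive_def simp_thms)

lemma sign_cochain_Z3:
  assumes "trilinear t"
  shows "sign_cochain t \<in> carrier (Z3 :: ('v::ab_group_add, 'k::field) cochain3 monoid)"
proof -
  have "t x y z + t w (x + y) z + t w x y = t (w + x) y z + t w x (y + z)" for w x y z
    unfolding trilinear_add[OF assms] by (simp only: ac_simps)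
  then show ?thesis
    by (simp add: sign_cochain_def Z3_def del: add_bit_eq_xor flip: bit_sign_add) (simp add: bit_sign_def)
qed

text \<open>The relation \<open>rel\<close> is the vanishing of the form on the diagonal where
  \<open>f\<close> and \<open>g\<close> are both 1.\<close>

lemma pair_B3:
  fixes f g :: "'v::ab_group_add \<Rightarrow> bit"
  assumes "additive f" "additive g" and rel: "c1 + c2 + c3 + d1 + d2 + d3 = 0"
  shows "sign_cochain (\<lambda>x y z. c1 * (f x * f y * g z) + c2 * (f x * g y * f z) + c3 * (g x * f y * f z)
      + (d1 * (f x * g y * g z) + d2 * (g x * f y * g z) + d3 * (g x * g y * f z)))
    \<in> (B3 :: ('v, 'k::alg_closed_field) cochain3 set)"
    (is "sign_cochain ?t \<in> _")
proof -
  have d3: "d3 = c1 + c2 + c3 + d1 + d2"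
    using rel by (metis bit_add_self(2) add.right_neutral add.commute)
  \<comment> \<open>Swaps collect the \<open>c\<close> terms at \<open>f x * f y * g z\<close> and
    the \<open>d\<close> terms at \<open>f x * g y * g z\<close>. By \<open>rel\<close> the two
    totals agree, leaving a multiple of the Bockstein relation.\<close>
  have eq: "?t = (\<lambda>x y z. (c1 + c2 + c3) * (f x * f y * g z + f x * g y * g z)
      + ((c2 + c3) * (f x * f y * g z + f x * g y * f z)
      + (c3 * (f x * g y * f z + g x * f y * f z)
      + ((d2 + d3) * (f x * g y * g z + g x * f y * g z)
      + d3 * (g x * f y * g z + g x * g y * f z)))))"
    unfolding d3 by (intro ext) (simp only: distrib_left distrib_right ac_simps bit_add_self
      mult_zero_left add_0_left add_0_right)
  show ?thesis
    unfolding eq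
    by (rule bockstein_B3 swap_left_B3 swap_right_B3 assms | rule sign_cochain_scale_B3
      | rule sign_cochain_add_B3)+
qed

lemma triple_B3:
  fixes f g h :: "'v::ab_group_add \<Rightarrow> bit"
  assumes "additive f" "additive g" "additive h" and rel: "c1 + c2 + c3 + c4 + c5 + c6 = 0"
  shows "sign_cochain (\<lambda>x y z. c1 * (f x * g y * h z) + c2 * (f x * h y * g z) + c3 * (g x * f y * h z)
      + c4 * (g x * h y * f z) + c5 * (h x * f y * g z) + c6 * (h x * g y * f z))
    \<in> (B3 :: ('v, 'k::alg_closed_field) cochain3 set)"
    (is "sign_cochain ?t \<in> _")
proof -
  have c6: "c6 = c1 + c2 + c3 + c4 + c5"
    using rel by (metis bit_add_self(2) add.right_neutral add.commute)
  \<comment> \<open>The swaps form a tree on the six orders of \<open>f\<close>, \<open>g\<close>,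
    \<open>h\<close>, rooted at the order \<open>f\<close>, \<open>g\<close>, \<open>h\<close>. Each
    edge carries the sum of the coefficients beyond it, and \<open>rel\<close> settles the
    root.\<close>
  have eq: "?t = (\<lambda>x y z. (c2 + c5 + c6) * (f x * g y * h z + f x * h y * g z)
      + ((c3 + c4) * (f x * g y * h z + g x * f y * h z)
      + (c4 * (g x * f y * h z + g x * h y * f z)
      + ((c5 + c6) * (f x * h y * g z + h x * f y * g z)
      + c6 * (h x * f y * g z + h x * g y * f z)))))"
    unfolding c6 by (intro ext) (simp only: distrib_left distrib_right ac_simps bit_add_self
      mult_zero_left add_0_left add_0_right)
  show ?thesis
    unfolding eq
    by (rule swap_left_B3 swap_right_B3 assms | rule sign_cochain_scale_B3
      | rule sign_cochain_add_B3)+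
qed

lemma zero_diagonal_B3:
  fixes t :: "(V3, bit) cochain3"
  assumes "trilinear t" and diag: "\<And>x. t x x x = 0"
  shows "sign_cochain t \<in> (B3 :: (V3, 'k::alg_closed_field) cochain3 set)"
proof -
  define e :: "3 \<Rightarrow> V3" where "e i = axis i 1" for i
  define c where "c i j k = t (e i) (e j) (e k)" for i j k
  have t_eq: "t x y z = (\<Sum>i\<in>UNIV. x $ i * (\<Sum>j\<in>UNIV. y $ j * (\<Sum>k\<in>UNIV. z $ k * c i j k)))" for x y z
    using assms(1) additive_bit_expansion[of "\<lambda>x. t x y z" x]
      additive_bit_expansion[of "\<lambda>y. t (e i) y z" y for i]
      additive_bit_expansion[of "t (e i) (e j)" z for i j]
    by (simp add: trilinear_def c_def e_def del: add_bit_eq_xor mult_bit_eq_and)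
  have c0: "c i i i = 0" for i
    by (simp add: c_def diag)
  \<comment> \<open>Polarization: the diagonal value at \<open>e i + e j\<close> consists of these
    mixed coefficients, the pure ones being 0.\<close>
  have c2: "c i i j + c i j i + c j i i + c i j j + c j i j + c j j i = 0" for i j
    using diag[of "e i + e j"] unfolding trilinear_add[OF assms(1)] c_def[symmetric] c0
    by (simp only: ac_simps add_0_left)
  \<comment> \<open>In the diagonal value at the sum of the basis, terms with two distinct indices
    cancel against the three pair sums.\<close>
  have "c 0 1 2 + c 0 2 1 + c 1 0 2 + c 1 2 0 + c 2 0 1 + c 2 1 0 =
      t (e 0 + e 1 + e 2) (e 0 + e 1 + e 2) (e 0 + e 1 + e 2)
      + (c 0 0 1 + c 0 1 0 + c 1 0 0 + c 0 1 1 + c 1 0 1 + c 1 1 0)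
      + (c 0 0 2 + c 0 2 0 + c 2 0 0 + c 0 2 2 + c 2 0 2 + c 2 2 0)
      + (c 1 1 2 + c 1 2 1 + c 2 1 1 + c 1 2 2 + c 2 1 2 + c 2 2 1)"
    unfolding trilinear_add[OF assms(1)] c_def[symmetric] c0
    by (simp only: ac_simps bit_add_self add_0_left add_0_right)
  then have c3: "c 0 1 2 + c 0 2 1 + c 1 0 2 + c 1 2 0 + c 2 0 1 + c 2 1 0 = 0"
    unfolding diag c2 by simp
  let ?pair = "\<lambda>i j x y z. c i i j * (x $ i * y $ i * z $ j) + c i j i * (x $ i * y $ j * z $ i)
    + c j i i * (x $ j * y $ i * z $ i) + (c i j j * (x $ i * y $ j * z $ j)
    + c j i j * (x $ j * y $ i * z $ j) + c j j i * (x $ j * y $ j * z $ i))"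
  \<comment> \<open>Monomials are grouped by the set of indices that they involve.\<close>
  have eq: "t = (\<lambda>x y z. ?pair 0 1 x y z + (?pair 0 2 x y z + (?pair 1 2 x y z
      + (c 0 1 2 * (x $ 0 * y $ 1 * z $ 2) + c 0 2 1 * (x $ 0 * y $ 2 * z $ 1)
      + c 1 0 2 * (x $ 1 * y $ 0 * z $ 2) + c 1 2 0 * (x $ 1 * y $ 2 * z $ 0)
      + c 2 0 1 * (x $ 2 * y $ 0 * z $ 1) + c 2 1 0 * (x $ 2 * y $ 1 * z $ 0)))))"
    by (intro ext) (simp only: t_eq sum_type_3 c0 distrib_left ac_simps
      mult_zero_left mult_zero_right add_0_left add_0_right)
  show ?thesis
    unfolding eq
    by (rule pair_B3 triple_B3 c2 c3 | rule sign_cochain_add_B3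
      | simp only: additive_def vector_add_component simp_thms)+
qed

section \<open>Classes of trilinear forms and their stabilizers\<close>

text \<open>
  The restriction of a class to the subgroup generated by \<open>x\<close>; the factor \<open>\<omega> x 0 x\<close> takes care
  of cochains that are not normalized.
\<close>

lemma cohomologous_diagonal:
  fixes \<omega> \<eta> :: "('v::group_add, 'k::field) cochain3"
  assumes "cohomologous \<omega> \<eta>" "x + x = 0"
  shows "\<omega> x x x * \<omega> x 0 x = \<eta> x x x * \<eta> x 0 x"
proof -
  obtain \<mu> where m: "\<forall>x y. \<mu> x y \<noteq> 0" "\<omega> = (\<lambda>x y z. coboundary2 \<mu> x y z * \<eta> x y z)"
    using assms(1) cohomologous_iff unfolding cohomologous_def by blast
  \<comment> \<open>As \<open>x + x = 0\<close>, the factors are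
    \<open>\<mu> x 0 / \<mu> 0 x\<close> and its inverse.\<close>
  have "coboundary2 \<mu> x x x * coboundary2 \<mu> x 0 x = 1"
    using m(1) assms(2) by (simp add: coboundary2_def divide_simps)
  then show ?thesis
    unfolding m(2) by (metis mult.assoc mult.left_commute mult_1_left)
qed

lemma cohomologous_sign_cochain_iff:
  fixes s t :: "(V3, bit) cochain3"
  assumes "trilinear s" "trilinear t"
  shows "cohomologous (sign_cochain s) (sign_cochain t :: (V3, 'k::{alg_closed_field, field_char_0}) cochain3)
    \<longleftrightarrow> (\<forall>x. s x x x = t x x x)" (is "?coh = ?eq")
proof
  assume ?coh
  have mid: "sign_cochain r x 0 x = (1::'k)" if "trilinear r" for r :: "(V3, bit) cochain3" and x
    using additive.zero[of "\<lambda>y. r x y x"] that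
    by (simp add: trilinear_def sign_cochain_def bit_sign_def)
  show ?eq
  proof
    fix x
    have "bit_sign (s x x x) = (bit_sign (t x x x) :: 'k)"
      using cohomologous_diagonal[OF \<open>?coh\<close> V3_add_self, of x]
      unfolding mid[OF assms(1)] mid[OF assms(2)] by (simp add: sign_cochain_def)
    \<comment> \<open>In characteristic 0 the signs 1 and -1 differ.\<close>
    then show "s x x x = t x x x"
      by (cases "s x x x"; cases "t x x x") (simp_all add: bit_sign_def)
  qed
next
  assume ?eq
  \<comment> \<open>Over F_2 the sum is the difference of the forms, so its diagonal
    vanishes.\<close>
  let ?d = "\<lambda>x y z. s x y z + t x y z"
  have "trilinear ?d"
    by (rule trilinearI) (simp_all only: trilinear_add[OF assms(1)] trilinear_add[OF assms(2)] ac_simps)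
  then have "sign_cochain ?d \<in> (B3 :: (V3, 'k) cochain3 set)"
    using \<open>?eq\<close> by (intro zero_diagonal_B3) (simp_all only: bit_add_self)
  then obtain \<mu> :: "V3 \<Rightarrow> V3 \<Rightarrow> 'k" where m: "sign_cochain ?d = coboundary2 \<mu>" "\<forall>x y. \<mu> x y \<noteq> 0"
    unfolding B3_def by blast
  have "sign_cochain s = (\<lambda>x y z. sign_cochain ?d x y z * (sign_cochain t x y z :: 'k))"
    unfolding sign_cochain_def bit_sign_add[symmetric] by (simp only: add.assoc bit_add_self add_0_right)
  then show ?coh
    using m(2) unfolding cohomologous_iff[OF sign_cochain_Z3 sign_cochain_Z3, OF assms] m(1) by blast
qed

text \<open>Pullback along an automorphism respects cohomology and trilinearity, so any
  representative may be traded for the sign of \<open>t\<close>, where the diagonal decides.\<close>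

lemma Stab_eq_diagonal:
  fixes t :: "(V3, bit) cochain3" and \<omega> :: "(V3, 'k::{alg_closed_field, field_char_0}) cochain3"
  assumes "trilinear t" "\<omega> \<in> H3_class (sign_cochain t)"
  shows "Stab \<omega> = {a \<in> auto V3_group. \<forall>x. t (a x) (a x) (a x) = t x x x}"
proof -
  interpret Z: group "Z3 :: (V3, 'k) cochain3 monoid"
    using comm_group_Z3 by (rule comm_group.axioms)
  have Z3: "\<omega> \<in> carrier Z3"
    using assms Z.r_coset_subset_G[OF subgroup.subset[OF subgroup_B3] sign_cochain_Z3]
    unfolding H3_class_def by blast
  have coh: "cohomologous \<omega> (sign_cochain t)"
    using assms Z3 Z.repr_independence[OF _ sign_cochain_Z3 subgroup_B3]
    by (simp add: cohomologous_def H3_class_def sign_cochain_Z3)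
  have "cohomologous (\<lambda>x y z. \<omega> (a x) (a y) (a z)) \<omega> \<longleftrightarrow> (\<forall>x. t (a x) (a x) (a x) = t x x x)"
    if a: "a \<in> auto V3_group" for a
  proof -
    let ?s = "\<lambda>x y z. t (a x) (a y) (a z)"
    have "a (x + y) = a x + a y" for x y
      using a by (simp add: auto_def hom_def V3_group_def)
    then have "trilinear ?s"
      by (intro trilinearI) (simp_all only: trilinear_add[OF assms(1)])
    have "cohomologous (\<lambda>x y z. \<omega> (a x) (a y) (a z)) (sign_cochain ?s)"
      using cohomologous_pullback[OF a coh] by (simp only: sign_cochain_def)
    then have "cohomologous (\<lambda>x y z. \<omega> (a x) (a y) (a z)) \<omega> \<longleftrightarrow>
        cohomologous (sign_cochain ?s) (sign_cochain t :: (V3, 'k) cochain3)"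
      using coh by (auto simp: cohomologous_def)
    then show ?thesis
      by (simp add: cohomologous_sign_cochain_iff[OF \<open>trilinear ?s\<close> assms(1)])
  qed
  then show ?thesis
    by (auto simp: Stab_def)
qed


section \<open>Permutations of coordinates as a stabilizer\<close>

text \<open>
  The coordinates \<open>c\<close> identify \<open>V\<^sub>3\<close> with a subspace of \<open>\<bbbF>\<^sub>2\<^sup>m\<close> on which the symmetric group acts.
\<close>

lemma symmetric_stabilizer_iso:
  fixes c :: "nat \<Rightarrow> V3 \<Rightarrow> bit" and F :: "V3 \<Rightarrow> 'b"
  assumes additive: "\<And>i. additive (c i)"
    and separating: "\<And>x y. (\<And>i. i \<in> {1..m} \<Longrightarrow> c i x = c i y) \<Longrightarrow> x = y"
    and inj: "inj_on c {1..m}"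
    and realize: "\<And>p x. p permutes {1..m} \<Longrightarrow> \<exists>y. \<forall>i\<in>{1..m}. c i y = c (p i) x"
    and symmetric: "\<And>p x y. p permutes {1..m} \<Longrightarrow> (\<And>i. i \<in> {1..m} \<Longrightarrow> c i y = c (p i) x) \<Longrightarrow> F y = F x"
    and stable: "\<And>a i. a \<in> auto V3_group \<Longrightarrow> (\<And>x. F (a x) = F x) \<Longrightarrow> i \<in> {1..m} \<Longrightarrow>
        \<exists>j\<in>{1..m}. \<forall>x. c i (a x) = c j x"
  shows "AutoGroup V3_group \<lparr>carrier := {a \<in> auto V3_group. \<forall>x. F (a x) = F x}\<rparr> \<cong> sym_group m"
proof -
  let ?G = "{a \<in> auto V3_group. \<forall>x. F (a x) = F x}"
  have auto_iff: "a \<in> auto V3_group \<longleftrightarrow> bij a \<and> (\<forall>x y. a (x + y) = a x + a y)" for a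
    by (auto simp: auto_def hom_def Bij_def V3_group_def)
  \<comment> \<open>\<open>A p\<close> permutes the coordinates by \<open>p\<close>; as these
    separate points, equations between vectors are checked coordinatewise.\<close>
  obtain A where A: "c i (A p x) = c (p i) x" if "p permutes {1..m}" "i \<in> {1..m}" for p i x
    using realize by metis
  have mem: "p i \<in> {1..m}" if "p permutes {1..m}" "i \<in> {1..m}" for p i
    using that by (simp only: permutes_in_image)
  \<comment> \<open>Relabelling of coordinates is contravariant.\<close>
  have A_comp: "A (q \<circ> p) = A p \<circ> A q" if "p permutes {1..m}" "q permutes {1..m}" for p q
  proof
    fix x
    show "A (q \<circ> p) x = (A p \<circ> A q) x"
      by (rule separating) (simp only: A that permutes_compose mem o_apply)
  qed
  have A_id: "A id = id"
  proof
    show "A id x = id x" for x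
      by (rule separating) (simp add: A permutes_id)
  qed
  have A_mem: "A p \<in> ?G" if p: "p permutes {1..m}" for p
  proof -
    have "A p \<circ> A (inv' p) = id" "A (inv' p) \<circ> A p = id"
      using A_comp[of p "inv' p"] A_comp[of "inv' p" p] p
      by (simp_all only: A_id permutes_inv permutes_inv_o)
    then have "bij (A p)"
      by (rule o_bij[rotated])
    moreover have "A p (x + y) = A p x + A p y" for x y
      by (rule separating) (simp only: A p additive[THEN additive.add])
    moreover have "F (A p x) = F x" for x
      using A p by (intro symmetric)
    ultimately show ?thesis
      by (simp add: auto_iff)
  qed
  have A_surj: "\<exists>p. p permutes {1..m} \<and> A p = a" if a: "a \<in> ?G" for a
  proof -
    obtain j where j: "j i \<in> {1..m}" "c i (a x) = c (j i) x" if "i \<in> {1..m}" for i x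
      using stable[of a] a by (simp only: mem_Collect_eq) metis
    \<comment> \<open>Functionals that agree after the surjection \<open>a\<close> are equal, and
      distinct indices carry distinct functionals.\<close>
    have "inj_on j {1..m}"
    proof (rule inj_onI)
      fix i i' assume i: "i \<in> {1..m}" "i' \<in> {1..m}" "j i = j i'"
      have "c i (a x) = c i' (a x)" for x
        using j(2) i by simp
      moreover have "surj a"
        using a by (simp add: auto_iff bij_is_surj)
      ultimately have "c i = c i'"
        by (metis surjD ext)
      then show "i = i'"
        using inj i by (meson inj_onD)
    qed
    then have "bij_betw j {1..m} {1..m}"
      using j(1) by (simp add: bij_betw_def endo_inj_surj image_subset_iff)
    \<comment> \<open>\<open>permutes\<close> demands the identity off the index set, so
      \<open>j\<close> is extended by it.\<close>
    then have p: "restrict_id j {1..m} permutes {1..m}"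
      by (rule permutes_restrict_id)
    have "A (restrict_id j {1..m}) x = a x" for x
      by (rule separating) (simp only: A[OF p] j(2) restrict_id_simps)
    with p show ?thesis
      by blast
  qed
  have A_inj: "p = q" if "p permutes {1..m}" "q permutes {1..m}" "A p = A q" for p q
  proof
    fix i
    show "p i = q i"
    proof (cases "i \<in> {1..m}")
      case True
      then have "c (p i) = c (q i)"
        using A[OF that(1) True] A[OF that(2) True] that(3) by auto
      then show ?thesis
        using inj mem that True by (meson inj_onD)
    qed (use that in \<open>simp add: permutes_not_in\<close>)
  qed
  \<comment> \<open>The inverse undoes the reversal of order in \<open>A_comp\<close>.\<close>
  let ?h = "\<lambda>p. A (inv' p)"
  have "?h \<in> Group.iso (sym_group m) (AutoGroup V3_group \<lparr>carrier := ?G\<rparr>)"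
    unfolding iso_iff
  proof (intro conjI)
    have "A p \<otimes>\<^bsub>AutoGroup V3_group\<^esub> A q = A p \<circ> A q"
      if "p permutes {1..m}" "q permutes {1..m}" for p q
      using A_mem that
      by (auto simp: AutoGroup_def BijGroup_def V3_group_def auto_def compose_def fun_eq_iff)
    then show "?h \<in> hom (sym_group m) (AutoGroup V3_group \<lparr>carrier := ?G\<rparr>)"
      using A_mem
      by (auto simp: hom_def sym_group_def permutes_inv o_inv_distrib permutes_bij A_comp)
    show "?h ` carrier (sym_group m) = carrier (AutoGroup V3_group \<lparr>carrier := ?G\<rparr>)"
    proof (intro equalityI subsetI)
      fix a assume "a \<in> carrier (AutoGroup V3_group \<lparr>carrier := ?G\<rparr>)"
      then obtain p where "p permutes {1..m}" "A p = a"
        using A_surj by auto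
      then show "a \<in> ?h ` carrier (sym_group m)"
        by (intro image_eqI[where x = "inv' p"]) (simp_all add: sym_group_def permutes_inv permutes_inv_inv)
    qed (use A_mem permutes_inv in \<open>auto simp: sym_group_def\<close>)
    show "inj_on ?h (carrier (sym_group m))"
      using A_inj by (intro inj_onI) (metis permutes_inv permutes_inv_inv sym_group_carrier)
  qed
  then show ?thesis
    using group.iso_sym[OF sym_group_is_group] by (auto simp: is_iso_def)
qed

section \<open>Coordinates adapted to the two cubics\<close>

lemma atLeastAtMost_1_3: "{1..3::nat} = {1, 2, 3}"
  by auto

lemma atLeastAtMost_1_4: "{1..4::nat} = {1, 2, 3, 4}"
  by auto

lemma additive_V3_expansion:
  assumes "additive (f :: V3 \<Rightarrow> bit)"
  shows "f x = x $ 0 * f (axis 0 1) + x $ 1 * f (axis 1 1) + x $ 2 * f (axis 2 1)"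
  using additive_bit_expansion[OF assms, of x] by (simp only: sum_type_3)

text \<open>The functionals with value \<open>1\<close> at \<open>(1, 1, 1)\<close>, indexed by \<open>1, \<dots>, 4\<close>.\<close>

definition coord_D :: "nat \<Rightarrow> V3 \<Rightarrow> bit" where
  "coord_D i x = (if i = 1 then x $ 0 else if i = 2 then x $ 1 else if i = 3 then x $ 2
     else x $ 0 + x $ 1 + x $ 2)"

text \<open>
  The basis dual to \<open>(1, 1, 0)\<close>, \<open>(1, 0, 1)\<close>, \<open>(1, 1, 1)\<close>, the vectors at which the cubic
  polynomial of \<open>\<omega>\<^sub>Q\<close> does not vanish; indexed by \<open>1, 2, 3\<close>.
\<close>

definition coord_Q :: "nat \<Rightarrow> V3 \<Rightarrow> bit" where
  "coord_Q i x = (if i = 1 then x $ 0 + x $ 2 else if i = 2 then x $ 0 + x $ 1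
     else x $ 0 + x $ 1 + x $ 2)"

lemma additive_coord_D: "additive (coord_D i)"
  by (simp add: additive_def coord_D_def ac_simps del: add_bit_eq_xor)

lemma additive_coord_Q: "additive (coord_Q i)"
  by (simp add: additive_def coord_Q_def ac_simps del: add_bit_eq_xor)

text \<open>The fourth functional is 1 wherever the other three are, so including it changes nothing
  and makes the symmetry under all four indices visible.\<close>

lemma cubic_D_eq_prod: "x $ 0 * x $ 1 * x $ 2 = (\<Prod>i\<in>{1..4}. coord_D i x)"
  unfolding atLeastAtMost_1_4
  by (cases "x $ 0"; cases "x $ 1"; cases "x $ 2") (simp_all add: coord_D_def)

text \<open>Both sides are 1 exactly where one of the three coordinates is 1 and the others are 0:
  three ones give \<open>1 + 1 = 0\<close>.\<close>

lemma cubic_Q_eq_sum_prod: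
  "x $ 0 * x $ 1 * x $ 2 + x $ 0 * x $ 1 * x $ 1 + x $ 0 * x $ 2 * x $ 2 =
    (\<Sum>i\<in>{1..3}. coord_Q i x) + (\<Prod>i\<in>{1..3}. coord_Q i x)"
  unfolding atLeastAtMost_1_3
  by (cases "x $ 0"; cases "x $ 1"; cases "x $ 2") (simp_all add: coord_Q_def)

lemma auto_V3_additive: "a \<in> auto V3_group \<Longrightarrow> additive a"
  by (simp add: auto_def hom_def V3_group_def additive_def)

lemma auto_V3_inj: "a \<in> auto V3_group \<Longrightarrow> inj a"
  by (simp add: auto_def Bij_def V3_group_def bij_betw_def)

section \<open>The stabilizers of the two cubics\<close>

lemma stabilizer_D_iso:
  "AutoGroup V3_group \<lparr>carrier := {a \<in> auto V3_group. \<forall>x. a x $ 0 * a x $ 1 * a x $ 2 = x $ 0 * x $ 1 * x $ 2}\<rparr>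
    \<cong> sym_group 4"
proof (rule symmetric_stabilizer_iso[where c = coord_D])
  show "x = y" if "\<And>i. i \<in> {1..4} \<Longrightarrow> coord_D i x = coord_D i y" for x y
    using that[of 1] that[of 2] that[of 3] by (simp add: coord_D_def V3_eq_iff)
  show "inj_on coord_D {1..4}"
  proof (rule inj_onI)
    fix i j assume ij: "i \<in> {1..4}" "j \<in> {1..4}" "coord_D i = coord_D j"
    have "coord_D i (axis k 1) = coord_D j (axis k 1)" for k
      using ij(3) by simp
    from this[of 0] this[of 1] this[of 2] show "i = j"
      using ij(1,2) unfolding atLeastAtMost_1_4 by (auto simp: coord_D_def axis_def split: if_splits)
  qed
next
  fix p x assume p: "p permutes {1..4::nat}"
  \<comment> \<open>The image of V_3 in F_2^4 lies in the sum-zero hyperplane, which permutations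
    preserve.\<close>
  have "(\<Sum>i\<in>{1..4}. coord_D i z) = 0" for z
    unfolding atLeastAtMost_1_4
    by (cases "z $ 0"; cases "z $ 1"; cases "z $ 2") (simp_all add: coord_D_def)
  then have "(\<Sum>i\<in>{1..4}. coord_D (p i) x) = 0"
    using sum.permute[OF p, of "\<lambda>i. coord_D i x"] by (simp add: comp_def)
  then have s: "coord_D (p 4) x = coord_D (p 1) x + coord_D (p 2) x + coord_D (p 3) x"
    unfolding atLeastAtMost_1_4
    by (cases "coord_D (p 1) x"; cases "coord_D (p 2) x"; cases "coord_D (p 3) x"; cases "coord_D (p 4) x") simp_all
  \<comment> \<open>The first three coordinates are prescribed; \<open>s\<close> then gives the
    fourth.\<close>
  show "\<exists>y. \<forall>i\<in>{1..4}. coord_D i y = coord_D (p i) x"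
    unfolding atLeastAtMost_1_4
    by (rule exI[of _ "\<chi> k. coord_D (p (if k = 0 then 1 else if k = 1 then 2 else 3)) x"])
      (use s in \<open>simp add: coord_D_def[of _ "vec_lambda _"]\<close>)
next
  fix p x y assume "p permutes {1..4::nat}" "\<And>i. i \<in> {1..4} \<Longrightarrow> coord_D i y = coord_D (p i) x"
  then show "y $ 0 * y $ 1 * y $ 2 = x $ 0 * x $ 1 * x $ 2"
    unfolding cubic_D_eq_prod using prod.permute[of p "{1..4}" "\<lambda>i. coord_D i x"]
    by (simp add: comp_def)
next
  fix a i assume a: "a \<in> auto V3_group" "\<And>x. a x $ 0 * a x $ 1 * a x $ 2 = x $ 0 * x $ 1 * x $ 2"
    and i: "i \<in> {1..4::nat}"
  define f where "f x = coord_D i (a x)" for x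
  have "additive f"
    using auto_V3_additive[OF a(1)] additive_coord_D[of i] by (simp add: f_def additive_def del: add_bit_eq_xor)
  \<comment> \<open>The vector \<open>1\<close> is (1, 1, 1), the only one where the cubic is
    1.\<close>
  have "a 1 = 1"
    using a(2)[of 1] by (cases "a 1 $ 0"; cases "a 1 $ 1"; cases "a 1 $ 2") (simp_all add: V3_eq_iff)
  then have "f 1 = 1"
    by (simp add: f_def coord_D_def)
  moreover obtain u v w where f: "f x = x $ 0 * u + x $ 1 * v + x $ 2 * w" for x
    using additive_V3_expansion[OF \<open>additive f\<close>] by blast
  ultimately have "u + v + w = 1"
    by simp
  \<comment> \<open>An odd number of the coefficients is 1, which leaves four functionals.\<close>
  then have "f = coord_D 1 \<or> f = coord_D 2 \<or> f = coord_D 3 \<or> f = coord_D 4"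
    by (cases u; cases v; cases w)
      (simp_all add: fun_eq_iff f coord_D_def del: add_bit_eq_xor mult_bit_eq_and)
  then show "\<exists>j\<in>{1..4}. \<forall>x. coord_D i (a x) = coord_D j x"
    unfolding atLeastAtMost_1_4 f_def[symmetric] by blast
qed (rule additive_coord_D)

lemma stabilizer_Q_iso:
  "AutoGroup V3_group \<lparr>carrier := {a \<in> auto V3_group. \<forall>x.
      a x $ 0 * a x $ 1 * a x $ 2 + a x $ 0 * a x $ 1 * a x $ 1 + a x $ 0 * a x $ 2 * a x $ 2 =
      x $ 0 * x $ 1 * x $ 2 + x $ 0 * x $ 1 * x $ 1 + x $ 0 * x $ 2 * x $ 2}\<rparr> \<cong> sym_group 3"
proof (rule symmetric_stabilizer_iso[where c = coord_Q])
  have e: "x $ 0 = coord_Q 1 x + coord_Q 2 x + coord_Q 3 x" "x $ 1 = coord_Q 1 x + coord_Q 3 x"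
    "x $ 2 = coord_Q 2 x + coord_Q 3 x" for x
    by (cases "x $ 0"; cases "x $ 1"; cases "x $ 2"; simp add: coord_Q_def)+
  show "x = y" if "\<And>i. i \<in> {1..3} \<Longrightarrow> coord_Q i x = coord_Q i y" for x y
    using that[of 1] that[of 2] that[of 3] by (simp add: V3_eq_iff e)
  show "inj_on coord_Q {1..3}"
  proof (rule inj_onI)
    fix i j assume ij: "i \<in> {1..3}" "j \<in> {1..3}" "coord_Q i = coord_Q j"
    have "coord_Q i (axis k 1) = coord_Q j (axis k 1)" for k
      using ij(3) by simp
    from this[of 0] this[of 1] this[of 2] show "i = j"
      using ij(1,2) unfolding atLeastAtMost_1_3 by (auto simp: coord_Q_def axis_def split: if_splits)
  qed
  fix p x assume "p permutes {1..3::nat}"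
  let ?\<alpha> = "coord_Q (p 1) x" and ?\<beta> = "coord_Q (p 2) x" and ?\<gamma> = "coord_Q (p 3) x"
  \<comment> \<open>The witness inverts the change of coordinates by the formulas in
    \<open>e\<close>.\<close>
  show "\<exists>y. \<forall>i\<in>{1..3}. coord_Q i y = coord_Q (p i) x"
    unfolding atLeastAtMost_1_3
    by (rule exI[of _ "\<chi> k. if k = 0 then ?\<alpha> + ?\<beta> + ?\<gamma> else if k = 1 then ?\<alpha> + ?\<gamma> else ?\<beta> + ?\<gamma>"],
        cases ?\<alpha>; cases ?\<beta>; cases ?\<gamma>) (simp_all add: coord_Q_def[of _ "vec_lambda _"])
next
  fix p x y assume "p permutes {1..3::nat}" "\<And>i. i \<in> {1..3} \<Longrightarrow> coord_Q i y = coord_Q (p i) x"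
  then show "y $ 0 * y $ 1 * y $ 2 + y $ 0 * y $ 1 * y $ 1 + y $ 0 * y $ 2 * y $ 2 =
      x $ 0 * x $ 1 * x $ 2 + x $ 0 * x $ 1 * x $ 1 + x $ 0 * x $ 2 * x $ 2"
    unfolding cubic_Q_eq_sum_prod using prod.permute[of p "{1..3}" "\<lambda>i. coord_Q i x"]
      sum.permute[of p "{1..3}" "\<lambda>i. coord_Q i x"]
    by (simp add: comp_def del: add_bit_eq_xor)
next
  let ?F = "\<lambda>x::V3. x $ 0 * x $ 1 * x $ 2 + x $ 0 * x $ 1 * x $ 1 + x $ 0 * x $ 2 * x $ 2"
  fix a i assume a: "a \<in> auto V3_group" "\<And>x. ?F (a x) = ?F x" and i: "i \<in> {1..3::nat}"
  define b1 b2 b3 :: V3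
    where b: "b1 = axis 0 1 + axis 1 1" "b2 = axis 0 1 + axis 2 1" "b3 = axis 0 1 + axis 1 1 + axis 2 1"
  define f where "f x = coord_Q i (a x)" for x
  have "additive f"
    using auto_V3_additive[OF a(1)] additive_coord_Q[of i] by (simp add: f_def additive_def del: add_bit_eq_xor)
  have comp: "b1 $ 0 = 1" "b1 $ 1 = 1" "b1 $ 2 = 0" "b2 $ 0 = 1" "b2 $ 1 = 0" "b2 $ 2 = 1"
    "b3 $ 0 = 1" "b3 $ 1 = 1" "b3 $ 2 = 1"
    by (simp_all add: b axis_def)
  have supp: "?F x = 1 \<longleftrightarrow> x \<in> {b1, b2, b3}" for x
    by (cases "x $ 0"; cases "x $ 1"; cases "x $ 2") (simp_all add: V3_eq_iff comp)
  have coord: "coord_Q 1 b1 = 1" "coord_Q 1 b2 = 0" "coord_Q 1 b3 = 0" "coord_Q 2 b1 = 0"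
    "coord_Q 2 b2 = 1" "coord_Q 2 b3 = 0" "coord_Q 3 b1 = 0" "coord_Q 3 b2 = 0" "coord_Q 3 b3 = 1"
    by (simp_all add: coord_Q_def comp)
  \<comment> \<open>\<open>a\<close> preserves the support of the cubic and is injective, so it
    permutes the basis.\<close>
  have "a b1 \<in> {b1, b2, b3}" "a b2 \<in> {b1, b2, b3}" "a b3 \<in> {b1, b2, b3}"
    unfolding supp[symmetric] a(2) by (simp_all add: comp)
  moreover have "a b1 \<noteq> a b2" "a b1 \<noteq> a b3" "a b2 \<noteq> a b3"
    unfolding inj_eq[OF auto_V3_inj[OF a(1)]] by (simp_all add: V3_eq_iff comp)
  ultimately have "(a b1, a b2, a b3) \<in> {(b1, b2, b3), (b1, b3, b2), (b2, b1, b3), (b2, b3, b1),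
      (b3, b1, b2), (b3, b2, b1)}" (is "_ \<in> ?perms")
    by (simp only: insert_iff empty_iff prod.inject) metis
  moreover have "(coord_Q i u, coord_Q i v, coord_Q i w) \<in> {(1, 0, 0), (0, 1, 0), (0, 0, 1)}"
    if "(u, v, w) \<in> ?perms" for u v w
    using i that coord unfolding atLeastAtMost_1_3
    by (simp only: insert_iff empty_iff prod.inject) metis
  ultimately have "(f b1, f b2, f b3) \<in> {(1, 0, 0), (0, 1, 0), (0, 0, 1)}"
    unfolding f_def by blast
  \<comment> \<open>Expansion of \<open>f\<close> in the dual basis: its values at the
    \<open>b\<close> vectors determine it, and just one of them is 1.\<close>
  moreover have "f x = coord_Q 1 x * f b1 + coord_Q 2 x * f b2 + coord_Q 3 x * f b3" for x
    unfolding additive_V3_expansion[OF \<open>additive f\<close>, of x] b additive.add[OF \<open>additive f\<close>]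
    by (cases "x $ 0"; cases "x $ 1"; cases "x $ 2"; cases "f (axis 0 1)"; cases "f (axis 1 1)";
        cases "f (axis 2 1)") (simp_all add: coord_Q_def)
  ultimately obtain u v w where uvw: "(u, v, w) \<in> {(1, 0, 0), (0, 1, 0), (0, 0, 1)}"
    and f: "f x = coord_Q 1 x * u + coord_Q 2 x * v + coord_Q 3 x * w" for x
    by blast
  have "f = coord_Q 1 \<or> f = coord_Q 2 \<or> f = coord_Q 3"
    using uvw by (auto simp: fun_eq_iff f simp del: add_bit_eq_xor mult_bit_eq_and)
  then show "\<exists>j\<in>{1..3}. \<forall>x. coord_Q i (a x) = coord_Q j x"
    unfolding atLeastAtMost_1_3 f_def[symmetric] by blast
qed (rule additive_coord_Q)

theorem proposition6p12:
  fixes \<omega>\<^sub>D \<omega>\<^sub>Q :: "(V3, 'k :: {alg_closed_field, field_char_0}) cochain3"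
  assumes "\<omega>\<^sub>D \<in> H3_of_cubic (X 0 * X 1 * X 2)"
    and "\<omega>\<^sub>Q \<in> H3_of_cubic (X 0 * X 1 * X 2 + X 0 * X 1 ^ 2 + X 0 * X 2 ^ 2)"
  shows "Stab_group \<omega>\<^sub>D \<cong> sym_group 4 \<and> Stab_group \<omega>\<^sub>Q \<cong> sym_group 3"
proof
  let ?D = "\<lambda>a b c :: V3. a $ 0 * b $ 1 * c $ 2"
  let ?Q = "\<lambda>a b c :: V3. a $ 0 * b $ 1 * c $ 2 + a $ 0 * b $ 1 * c $ 1 + a $ 0 * b $ 2 * c $ 2"
  have tri: "trilinear ?D" "trilinear ?Q"
    by (rule trilinearI; simp only: vector_add_component distrib_left distrib_right ac_simps)+
  have mem: "\<omega>\<^sub>D \<in> H3_class (sign_cochain ?D)" "\<omega>\<^sub>Q \<in> H3_class (sign_cochain ?Q)"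
    using assms by (simp_all only: H3_of_cubic_def cubic_cocycle_D cubic_cocycle_Q sign_cochain_def)
  show "Stab_group \<omega>\<^sub>D \<cong> sym_group 4"
    unfolding Stab_group_def Stab_eq_diagonal[OF tri(1) mem(1)] by (rule stabilizer_D_iso)
  show "Stab_group \<omega>\<^sub>Q \<cong> sym_group 3"
    unfolding Stab_group_def Stab_eq_diagonal[OF tri(2) mem(2)] by (rule stabilizer_Q_iso)
qed

end
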